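(* Let $N\ge 1$ be an integer, $n_{sa}$ a positive integer divisible by $N$, $\sigma^2>0$ and $Q^*_{sa}\in\mathbb{R}$. Suppose the $n_{sa}$ samples for the state-action pair $(s,a)$, which have mean $Q^*_{sa}$ and variance $\sigma^2$, are evenly allocated amongst $N$ estimators, so that each estimator $Q^i_{sa}$, $i=1,\dots,N$, is a sample mean over $n_{sa}/N$ samples and thus has mean $Q^*_{sa}$ and variance $\sigma^2N/n_{sa}$. Let $Q_{sa}$ be the single estimator that averages all $n_{sa}$ samples, so that $\mathrm{Var}[Q_{sa}]=\sigma^2/n_{sa}$. Assume that the errors $e^i_{sa}=Q^i_{sa}-Q^*_{sa}$, $i=1,\dots,N$, are independent and uniformly distributed on $(-\tau,\tau)$ for some $\tau>0$, and let $Q^{\min}_{sa}=\min_{1\le i\le N}Q^i_{sa}$. Then $\tau=\sqrt{3\sigma^2N/n_{sa}}$ and $$\mathrm{Var}[Q^{\min}_{sa}]=\frac{12N^2}{(N+1)^2(N+2)}\,\mathrm{Var}[Q_{sa}].$$ In particular, for $N\ge 8$, $\mathrm{Var}[Q^{\min}_{sa}]<\mathrm{Var}[Q_{sa}]$.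
   Context: The uniform distribution of the errors is a modelling assumption on the estimators; the sample averages enter only through their means and variances, i.e. $E[Q^i_{sa}]=Q^*_{sa}$, $\mathrm{Var}[Q^i_{sa}]=\sigma^2N/n_{sa}$ and $\mathrm{Var}[Q_{sa}]=\sigma^2/n_{sa}$ may be taken as the hypotheses encoding the even allocation of the samples. *)

theory Defs
  imports "HOL-Probability.Probability"
begin

end

theory Submission
  imports Defs
begin

text \<open>With \<open>Y\<^sub>i = \<tau> - e\<^sub>i\<close>, uniform on \<open>[0, 2\<tau>]\<close>, the minimum of the estimators is
  \<open>Q\<^sup>* + \<tau> - max Y\<^sub>i\<close>, so its variance is that of \<open>max Y\<^sub>i\<close>. The latter has distribution function
  \<open>(x / 2\<tau>)\<^sup>N\<close>, whose first two moments are elementary. The width \<open>\<tau>\<close> follows by comparing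
  \<open>(2\<tau>)\<^sup>2 / 12\<close> with the prescribed variance.\<close>

text \<open>Clamping \<open>a\<close> to \<open>[0, c]\<close> lets one formula serve every real
  \<open>a\<close>, as the distribution function of the maximum requires. Outside the interval,
  monotonicity of \<open>prob\<close> compares with the endpoint values 0 and 1.\<close>

lemma (in prob_space) uniform_distributed_cdf:
  fixes X :: "'a \<Rightarrow> real"
  assumes D: "distributed M lborel X (\<lambda>x. indicator {0..c} x / measure lborel {0..c})"
  shows "prob {\<omega> \<in> space M. X \<omega> \<le> a} = max 0 (min a c) / c"
proof -
  have c: "0 < c"
    using uniform_distributed_bounds[OF D] .
  have [measurable]: "X \<in> borel_measurable M"
    using distributed_measurable[OF D] by simp
  consider "a < 0" | "0 \<le> a" "a \<le> c" | "c < a"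
    by linarith
  then show ?thesis
  proof cases
    case 1
    have "prob {\<omega> \<in> space M. X \<omega> \<le> a} \<le> prob {\<omega> \<in> space M. X \<omega> \<le> 0}"
      using 1 by (intro finite_measure_mono) auto
    also have "\<dots> = 0"
      using uniform_distributed_measure[OF D, of 0] c by simp
    finally show ?thesis
      using 1 by (simp add: measure_le_0_iff)
  next
    case 2
    then show ?thesis
      using uniform_distributed_measure[OF D 2] by simp
  next
    case 3
    have "1 = prob {\<omega> \<in> space M. X \<omega> \<le> c}"
      using uniform_distributed_measure[OF D, of c] c by simp
    also have "\<dots> \<le> prob {\<omega> \<in> space M. X \<omega> \<le> a}"
      using 3 by (intro finite_measure_mono) auto
    finally show ?thesis
      using 3 c by (simp add: antisym)
  qed
qed

text \<open>The maximum is at most \<open>a\<close> iff every \<open>X i\<close> is, so independence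
  turns its distribution function into a power of the common one. The density is the derivative of
  \<open>(x / c) ^ card I\<close> on \<open>[0, c]\<close>.\<close>

lemma (in prob_space) uniform_distributed_Max:
  fixes X :: "'i \<Rightarrow> 'a \<Rightarrow> real"
  assumes I: "finite I" "I \<noteq> {}" and c: "0 < c"
    and indep: "indep_vars (\<lambda>_. borel) X I"
    and D: "\<And>i. i \<in> I \<Longrightarrow>
      distributed M lborel (X i) (\<lambda>x. indicator {0..c} x / measure lborel {0..c})"
  shows "distributed M lborel (\<lambda>\<omega>. MAX i\<in>I. X i \<omega>)
    (\<lambda>x. real (card I) / c ^ card I * (x ^ (card I - 1) * indicator {0..c} x))"
proof (rule distributedI_borel_atMost)
  have X[measurable]: "X i \<in> borel_measurable M" if "i \<in> I" for i
    using distributed_measurable[OF D[OF that]] by simp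
  show "(\<lambda>\<omega>. MAX i\<in>I. X i \<omega>) \<in> borel_measurable M"
    using I by (intro borel_measurable_Max) auto
  fix a :: real
  define n where "n = card I"
  have n: "0 < n"
    using I by (simp add: n_def card_gt_0_iff)
  define m where "m = max 0 (min a c)"
  have "{\<omega> \<in> space M. (MAX i\<in>I. X i \<omega>) \<le> a} = (\<Inter>i\<in>I. X i -` {..a} \<inter> space M)"
    using I by auto
  then have "prob {\<omega> \<in> space M. (MAX i\<in>I. X i \<omega>) \<le> a} = (\<Prod>i\<in>I. prob (X i -` {..a} \<inter> space M))"
    using indep_varsD_finite[OF indep, of "\<lambda>_. {..a}"] I by simp
  also have "\<dots> = (\<Prod>i\<in>I. m / c)"
  proof (intro prod.cong refl)
    fix i assume "i \<in> I"
    have "X i -` {..a} \<inter> space M = {\<omega> \<in> space M. X i \<omega> \<le> a}"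
      by auto
    with uniform_distributed_cdf[OF D[OF \<open>i \<in> I\<close>], of a]
    show "prob (X i -` {..a} \<inter> space M) = m / c"
      by (simp add: m_def)
  qed
  finally show "emeasure M {\<omega> \<in> space M. (MAX i\<in>I. X i \<omega>) \<le> a} = ennreal ((max 0 (min a c) / c) ^ card I)"
    by (simp add: emeasure_eq_measure m_def)
  \<comment> \<open>Equality holds only almost everywhere: for \<open>a < 0\<close> the interval
    \<open>{0..m}\<close> shrinks to the point 0, where the right integrand is nonzero if
    \<open>n = 1\<close>.\<close>
  have "(\<integral>\<^sup>+x. ennreal (real n / c ^ n * (x ^ (n - 1) * indicator {0..c} x) * indicator {..a} x) \<partial>lborel)
      = (\<integral>\<^sup>+x. ennreal (real n / c ^ n * x ^ (n - 1)) * indicator {0..m} x \<partial>lborel)"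
    using c AE_lborel_singleton[of "0::real"]
    by (intro nn_integral_cong_AE) (auto simp: m_def split: split_indicator elim!: eventually_mono)
  also have "\<dots> = ennreal (m ^ n / c ^ n - 0 ^ n / c ^ n)"
  proof (rule nn_integral_FTC_Icc)
    fix x :: real
    show "((\<lambda>x. x ^ n / c ^ n) has_real_derivative real n / c ^ n * x ^ (n - 1)) (at x)"
      using c by (auto intro!: derivative_eq_intros)
  qed (use c in \<open>auto simp: m_def\<close>)
  finally show "(\<integral>\<^sup>+x. ennreal (real (card I) / c ^ card I * (x ^ (card I - 1) * indicator {0..c} x) *
      indicator {..a} x) \<partial>lborel) = ennreal ((max 0 (min a c) / c) ^ card I)"
    using n by (simp add: n_def m_def power_divide zero_power)
qed (use c in \<open>auto split: split_indicator\<close>)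

text \<open>Integrating \<open>x ^ k\<close> against the density gives the moments
  \<open>n * c ^ k / (n + k)\<close>; the cases \<open>k = 1\<close> and \<open>k = 2\<close>
  determine mean and variance.\<close>

lemma (in prob_space)
  fixes Y :: "'a \<Rightarrow> real"
  assumes n: "0 < n" and c: "0 < c"
    and D: "distributed M lborel Y (\<lambda>x. real n / c ^ n * (x ^ (n - 1) * indicator {0..c} x))"
  shows power_law_integrable: "integrable M Y"
    and power_law_expectation: "expectation Y = real n * c / (real n + 1)"
    and power_law_variance: "variance Y = real n * c\<^sup>2 / ((real n + 1)\<^sup>2 * (real n + 2))"
proof -
  let ?f = "\<lambda>x. real n / c ^ n * (x ^ (n - 1) * indicator {0..c} x)"
  have f: "0 \<le> ?f x" for x
    using c by (auto split: split_indicator)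
  \<comment> \<open>Positivity of \<open>n\<close> matters here: with truncated subtraction,
    \<open>n - 1 + k = n + k - 1\<close> needs it.\<close>
  have eq: "?f x * x ^ k = real n / c ^ n * (x ^ (n + k - 1) * indicator {0..c} x)" for x k
    using n by (simp add: power_add[symmetric])
  have int: "integrable M (\<lambda>\<omega>. Y \<omega> ^ k)" for k
  proof (subst distributed_integrable[OF D, symmetric])
    have "integrable lborel (\<lambda>x::real. x ^ (n + k - 1) * indicator {0..c} x)"
      by (rule borel_integrable_atLeastAtMost) auto
    then show "integrable lborel (\<lambda>x. ?f x * x ^ k)"
      unfolding eq by (rule integrable_mult_right)
  qed (use f in auto)
  have moment: "expectation (\<lambda>\<omega>. Y \<omega> ^ k) = real n * c ^ k / (real n + real k)" for k
  proof -
    have "expectation (\<lambda>\<omega>. Y \<omega> ^ k) = (\<integral>x. ?f x * x ^ k \<partial>lborel)"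
      using f by (intro distributed_integral[OF D, symmetric]) auto
    also have "\<dots> = real n / c ^ n * (c ^ (n + k) / (real n + real k))"
      unfolding eq using n c by (simp add: integral_power zero_power)
    also have "\<dots> = real n * c ^ k / (real n + real k)"
      using c by (simp add: power_add)
    finally show ?thesis .
  qed
  show "integrable M Y"
    using int[of 1] by simp
  show E: "expectation Y = real n * c / (real n + 1)"
    using moment[of 1] by simp
  have "variance Y = real n * c\<^sup>2 / (real n + 2) - (real n * c / (real n + 1))\<^sup>2"
    using variance_eq[of Y] int[of 1] int[of 2] moment[of 2] E by simp
  \<comment> \<open>Over the common denominator the numerator collapses, since
    \<open>(n + 1)^2 - n * (n + 2) = 1\<close>.\<close>
  also have "\<dots> = real n * c\<^sup>2 / ((real n + 1)\<^sup>2 * (real n + 2))"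
    using n by (simp add: divide_simps) (simp add: algebra_simps power2_eq_square)
  finally show "variance Y = real n * c\<^sup>2 / ((real n + 1)\<^sup>2 * (real n + 2))" .
qed

lemma (in prob_space) variance_reflect:
  fixes Y :: "'a \<Rightarrow> real"
  assumes "integrable M Y"
  shows "variance (\<lambda>\<omega>. a - Y \<omega>) = variance Y"
  using assms by (simp add: prob_space power2_commute)

text \<open>The two endpoints form a null set and both intervals have the same length, so the
  densities agree almost everywhere.\<close>

lemma distributed_Ioo_imp_Icc:
  fixes a b :: real
  assumes "distributed M lborel X (\<lambda>x. indicator {a<..<b} x / measure lborel {a<..<b})"
  shows "distributed M lborel X (\<lambda>x. indicator {a..b} x / measure lborel {a..b})"
proof -
  have "AE x in lborel. ennreal (indicator {a<..<b} x / measure lborel {a<..<b}) =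
      ennreal (indicator {a..b} x / measure lborel {a..b})"
    using AE_lborel_singleton[of a] AE_lborel_singleton[of b]
    by eventually_elim (auto split: split_indicator)
  then show ?thesis
    using assms by (subst (asm) distributed_cong_density) auto
qed

text \<open>The affine map with slope -1 and offset \<open>t\<close> carries \<open>[-t, t]\<close>
  onto \<open>[0, 2t]\<close> and preserves length. Reversing the order is what exchanges minimum
  and maximum.\<close>

lemma (in prob_space) uniform_distributed_reflect:
  fixes X :: "'a \<Rightarrow> real"
  assumes "distributed M lborel X (\<lambda>x. indicator {-t..t} x / measure lborel {-t..t})"
  shows "distributed M lborel (\<lambda>\<omega>. t - X \<omega>) (\<lambda>x. indicator {0..2*t} x / measure lborel {0..2*t})"
proof -
  have "(\<lambda>x. ennreal (indicator {-t..t} ((x - t) / -1) / measure lborel {-t..t}) / ennreal \<bar>-1\<bar>)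
      = (\<lambda>x. ennreal (indicator {0..2*t} x / measure lborel {0..2*t}))"
    by (intro ext) (auto simp: divide_ennreal_def split: split_indicator)
  then show ?thesis
    using distributed_affine[OF assms, of "-1" t] by simp
qed

text \<open>The expanded denominator contains \<open>4 * x^2\<close>, and for
  \<open>8 \<le> x\<close> its cubic term supplies the other \<open>8 * x^2\<close>; the positive
  lower-order terms make the inequality strict.\<close>

lemma variance_factor_less_1:
  fixes x :: real
  assumes "8 \<le> x"
  shows "12 * x\<^sup>2 / ((x + 1)\<^sup>2 * (x + 2)) < 1"
proof -
  have "8 * x\<^sup>2 \<le> x * x\<^sup>2"
    using assms by (intro mult_right_mono) auto
  moreover have "(x + 1)\<^sup>2 * (x + 2) = x * x\<^sup>2 + 4 * x\<^sup>2 + 5 * x + 2"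
    by algebra
  ultimately have "12 * x\<^sup>2 < (x + 1)\<^sup>2 * (x + 2)"
    using assms by linarith
  then show ?thesis
    using assms by (subst divide_less_eq_1_pos) auto
qed

theorem corollary1:
  fixes M :: "'w measure"
    and N n_sa :: nat
    and \<sigma> \<tau> Qstar :: real
    and Q :: "nat \<Rightarrow> 'w \<Rightarrow> real"
    and Qsingle :: "'w \<Rightarrow> real"
  assumes "prob_space M"
    and "N \<ge> 1" and "n_sa > 0" and "N dvd n_sa" and "\<sigma>\<^sup>2 > 0" and "\<tau> > 0"
    and "\<And>i. i \<in> {1..N} \<Longrightarrow> Q i \<in> borel_measurable M"
    and "Qsingle \<in> borel_measurable M"
    and "\<And>i. i \<in> {1..N} \<Longrightarrow> prob_space.expectation M (Q i) = Qstar"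
    and "\<And>i. i \<in> {1..N} \<Longrightarrow> prob_space.variance M (Q i) = \<sigma>\<^sup>2 * real N / real n_sa"
    and "prob_space.variance M Qsingle = \<sigma>\<^sup>2 / real n_sa"
    and "prob_space.indep_vars M (\<lambda>_. borel) (\<lambda>i \<omega>. Q i \<omega> - Qstar) {1..N}"
    and "\<And>i. i \<in> {1..N} \<Longrightarrow>
      distributed M lborel (\<lambda>\<omega>. Q i \<omega> - Qstar)
        (\<lambda>x. indicator {-\<tau><..<\<tau>} x / measure lborel {-\<tau><..<\<tau>})"
  shows "\<tau> = sqrt (3 * \<sigma>\<^sup>2 * real N / real n_sa)
    \<and> prob_space.variance M (\<lambda>\<omega>. MIN i\<in>{1..N}. Q i \<omega>)
        = 12 * (real N)\<^sup>2 / ((real N + 1)\<^sup>2 * (real N + 2)) * prob_space.variance M Qsingle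
    \<and> (N \<ge> 8 \<longrightarrow>
        prob_space.variance M (\<lambda>\<omega>. MIN i\<in>{1..N}. Q i \<omega>) < prob_space.variance M Qsingle)"
proof -
  interpret prob_space M by fact
  let ?Y = "\<lambda>i \<omega>. \<tau> - (Q i \<omega> - Qstar)"
  note N = \<open>N \<ge> 1\<close> and n = \<open>n_sa > 0\<close> and \<sigma> = \<open>\<sigma>\<^sup>2 > 0\<close> and \<tau> = \<open>\<tau> > 0\<close>
  have D: "distributed M lborel (\<lambda>\<omega>. Q i \<omega> - Qstar)
      (\<lambda>x. indicator {-\<tau>..\<tau>} x / measure lborel {-\<tau>..\<tau>})" if "i \<in> {1..N}" for i
    using assms(13)[OF that] by (rule distributed_Ioo_imp_Icc)
  have "variance (\<lambda>\<omega>. Q 1 \<omega> - Qstar) = (\<tau> - (- \<tau>))\<^sup>2 / 12"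
    using N by (intro uniform_distributed_variance D) auto
  \<comment> \<open>As the error has mean 0 and \<open>Q 1\<close> has mean \<open>Qstar\<close>,
    both variances are the expectation of \<open>(Q 1 \<omega> - Qstar)^2\<close>. Equating their
    values gives \<open>\<tau>^2 / 3 = \<sigma>^2 * N / n_sa\<close>.\<close>
  moreover have "expectation (\<lambda>\<omega>. Q 1 \<omega> - Qstar) = (- \<tau> + \<tau>) / 2"
    using N by (intro uniform_distributed_expectation D) auto
  moreover have "variance (Q 1) = \<sigma>\<^sup>2 * real N / real n_sa" "expectation (Q 1) = Qstar"
    using N assms(9,10) by auto
  ultimately have \<tau>2: "\<tau>\<^sup>2 = 3 * \<sigma>\<^sup>2 * real N / real n_sa"
    by (simp add: power2_eq_square ac_simps)
  have "distributed M lborel (\<lambda>\<omega>. MAX i\<in>{1..N}. ?Y i \<omega>)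
      (\<lambda>x. real (card {1..N}) / (2*\<tau>) ^ card {1..N} * (x ^ (card {1..N} - 1) * indicator {0..2*\<tau>} x))"
  proof (rule uniform_distributed_Max)
    show "indep_vars (\<lambda>_. borel) ?Y {1..N}"
      using indep_vars_compose2[OF assms(12), of "\<lambda>_ x. \<tau> - x"] by simp
    fix i assume "i \<in> {1..N}"
    then show "distributed M lborel (?Y i) (\<lambda>x. indicator {0..2*\<tau>} x / measure lborel {0..2*\<tau>})"
      by (intro uniform_distributed_reflect D)
  qed (use N \<tau> in auto)
  then have Y: "distributed M lborel (\<lambda>\<omega>. MAX i\<in>{1..N}. ?Y i \<omega>)
      (\<lambda>x. real N / (2*\<tau>) ^ N * (x ^ (N - 1) * indicator {0..2*\<tau>} x))"
    by simp
  \<comment> \<open>Each \<open>Q i \<omega>\<close> equals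
    \<open>(Qstar + \<tau>) - ?Y i \<omega>\<close>, so an index attaining the maximum of
    \<open>?Y\<close> attains the minimum of \<open>Q\<close>.\<close>
  have "(MIN i\<in>{1..N}. Q i \<omega>) = (Qstar + \<tau>) - (MAX i\<in>{1..N}. ?Y i \<omega>)" for \<omega>
  proof (rule Min_eqI)
    fix y assume "y \<in> (\<lambda>i. Q i \<omega>) ` {1..N}"
    then obtain i where i: "i \<in> {1..N}" "y = Q i \<omega>" by auto
    have "?Y i \<omega> \<le> (MAX i\<in>{1..N}. ?Y i \<omega>)"
      using i by (intro Max_ge) auto
    then show "(Qstar + \<tau>) - (MAX i\<in>{1..N}. ?Y i \<omega>) \<le> y"
      unfolding i(2) by linarith
  next
    have "(MAX i\<in>{1..N}. ?Y i \<omega>) \<in> (\<lambda>i. ?Y i \<omega>) ` {1..N}"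
      using N by (intro Max_in) auto
    then obtain i where "i \<in> {1..N}" "(MAX i\<in>{1..N}. ?Y i \<omega>) = ?Y i \<omega>" by auto
    then show "(Qstar + \<tau>) - (MAX i\<in>{1..N}. ?Y i \<omega>) \<in> (\<lambda>i. Q i \<omega>) ` {1..N}"
      by auto
  qed simp
  then have "variance (\<lambda>\<omega>. MIN i\<in>{1..N}. Q i \<omega>)
      = variance (\<lambda>\<omega>. (Qstar + \<tau>) - (MAX i\<in>{1..N}. ?Y i \<omega>))"
    by presburger
  also have "\<dots> = variance (\<lambda>\<omega>. MAX i\<in>{1..N}. ?Y i \<omega>)"
    using N \<tau> by (intro variance_reflect power_law_integrable[OF _ _ Y]) auto
  also have "\<dots> = real N * (2*\<tau>)\<^sup>2 / ((real N + 1)\<^sup>2 * (real N + 2))"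
    using N \<tau> by (intro power_law_variance[OF _ _ Y]) auto
  \<comment> \<open>The constant 12 is the 4 from \<open>(2*\<tau>)^2\<close> times the 3 in
    \<open>\<tau>2\<close>, which also supplies the second factor \<open>N\<close>.\<close>
  also have "\<dots> = 12 * (real N)\<^sup>2 / ((real N + 1)\<^sup>2 * (real N + 2)) * variance Qsingle"
    unfolding assms(11) by (simp add: power_mult_distrib \<tau>2) (simp add: power2_eq_square ac_simps)
  finally have V: "variance (\<lambda>\<omega>. MIN i\<in>{1..N}. Q i \<omega>)
      = 12 * (real N)\<^sup>2 / ((real N + 1)\<^sup>2 * (real N + 2)) * variance Qsingle" .
  have "0 < variance Qsingle"
    unfolding assms(11) using \<sigma> n by simp
  then have "variance (\<lambda>\<omega>. MIN i\<in>{1..N}. Q i \<omega>) < variance Qsingle" if "N \<ge> 8"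
    unfolding V using mult_strict_right_mono[OF variance_factor_less_1[of "real N"]] that by simp
  \<comment> \<open>Since \<open>\<tau>\<close> is positive, it is the nonnegative root of
    \<open>\<tau>^2\<close>.\<close>
  moreover have "\<tau> = sqrt (3 * \<sigma>\<^sup>2 * real N / real n_sa)"
    using \<tau> by (simp flip: \<tau>2)
  ultimately show ?thesis
    using V by blast
qed

end
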